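(* Let $G$ be a connected graph whose longest path has length $p$ and with $c(G) \geq t$. Then there exists a $(P_{2p+1},\text{claw},\text{butterfly},C_4,C_5)$-free graph $H$ with $c(H) \geq t$.
   Context: The length of a path is its number of vertices (so a graph whose longest path has length $p$ contains $P_p$ but not $P_{p+1}$ as a subgraph). Cops and Robbers is played on a connected graph: first the cops are placed on vertices, then the robber chooses a vertex; players alternate turns (cops first), each cop/robber moving to an adjacent vertex or staying put; the cops win if a cop eventually moves onto the robber's vertex. The cop number $c(G)$ is the least number of cops guaranteeing a cop win. A graph is $(H_1,\dots,H_m)$-free if it has no induced subgraph isomorphic to any $H_i$. $P_t$ and $C_t$ denote the path and cycle on $t$ vertices; the claw is $K_{1,3}$; the butterfly is the 5-vertex graph obtained by identifying two triangles at one vertex. *)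

theory Defs
  imports "Graph_Theory.Graph_Theory"
begin

(* Finite simple graphs are rendered by the locale pair_graph of Graph_Theory: finite, loop-free
   digraphs without parallel arcs whose arc relation is symmetric. *)

definition undirected :: "'a set \<Rightarrow> ('a \<times> 'a) set \<Rightarrow> 'a pair_pre_digraph" where
  "undirected V E = \<lparr>pverts = V, parcs = E \<union> E\<inverse>\<rparr>"

(* n counts vertices, as in P_n. *)
definition path_graph :: "nat \<Rightarrow> nat pair_pre_digraph" where
  "path_graph n = undirected {..<n} {(i, Suc i) | i. Suc i < n}"

(* Meaningful for n >= 3 only. *)
definition cycle_graph :: "nat \<Rightarrow> nat pair_pre_digraph" where
  "cycle_graph n = undirected {..<n} {(i, Suc i mod n) | i. i < n}"

definition claw :: "nat pair_pre_digraph" where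
  "claw = undirected {..<4} {(0, 1), (0, 2), (0, 3)}"

definition butterfly :: "nat pair_pre_digraph" where
  "butterfly = undirected {..<5} {(0, 1), (0, 2), (1, 2), (0, 3), (0, 4), (3, 4)}"

definition induced_free :: "'b pair_pre_digraph set \<Rightarrow> 'a pair_pre_digraph \<Rightarrow> bool" where
  "induced_free Fs G \<longleftrightarrow>
     (\<forall>F \<in> Fs. \<not> (\<exists>K. induced_subgraph K (with_proj G) \<and> digraph_iso K (with_proj F)))"

(* The length of a path is its number of vertices; vpath q G says that the nonempty list q
   of distinct vertices is a (not necessarily induced) path of G. *)
definition longest_path_length :: "'a pair_pre_digraph \<Rightarrow> nat \<Rightarrow> bool" where
  "longest_path_length G p \<longleftrightarrow>
     (\<exists>q. vpath q (with_proj G) \<and> length q = p) \<and>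
     (\<forall>q. vpath q (with_proj G) \<longrightarrow> length q \<le> p)"


definition legal_move :: "'a pair_pre_digraph \<Rightarrow> 'a \<Rightarrow> 'a \<Rightarrow> bool" where
  "legal_move G u v \<longleftrightarrow> u \<in> pverts G \<and> (v = u \<or> (u, v) \<in> parcs G)"

(* r 0 is the vertex the robber chooses initially, r n his position after n moves. *)
definition robber_play :: "'a pair_pre_digraph \<Rightarrow> (nat \<Rightarrow> 'a) \<Rightarrow> bool" where
  "robber_play G r \<longleftrightarrow> r 0 \<in> pverts G \<and> (\<forall>n. legal_move G (r n) (r (Suc n)))"

(* A strategy for the cops maps the list of all robber positions seen so far, oldest first, to
   the next position of each cop (cop i for i < k); its value on [] is the initial placement.
   The positions of the cops after n moves, when the robber plays r: *)
definition cops_at :: "('a list \<Rightarrow> nat \<Rightarrow> 'a) \<Rightarrow> (nat \<Rightarrow> 'a) \<Rightarrow> nat \<Rightarrow> nat \<Rightarrow> 'a" where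
  "cops_at \<sigma> r n = \<sigma> (map r [0..<n])"

(* The cops make their move number n + 1 while the robber is at r n, and win if this puts some
   cop onto r n. A robber who walks onto a cop is caught by that cop staying put. Plays are
   formally continued forever; what happens after a capture is irrelevant. *)
definition winning_strategy ::
  "'a pair_pre_digraph \<Rightarrow> nat \<Rightarrow> ('a list \<Rightarrow> nat \<Rightarrow> 'a) \<Rightarrow> bool" where
  "winning_strategy G k \<sigma> \<longleftrightarrow>
     (\<forall>i<k. \<sigma> [] i \<in> pverts G) \<and>
     (\<forall>r. robber_play G r \<longrightarrow>
        (\<forall>n. \<forall>i<k. legal_move G (cops_at \<sigma> r n i) (cops_at \<sigma> r (Suc n) i)) \<and>
        (\<exists>n. \<exists>i<k. cops_at \<sigma> r (Suc n) i = r n))"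

definition cops_win :: "'a pair_pre_digraph \<Rightarrow> nat \<Rightarrow> bool" where
  "cops_win G k \<longleftrightarrow> (\<exists>\<sigma>. winning_strategy G k \<sigma>)"

definition cop_number :: "'a pair_pre_digraph \<Rightarrow> nat" where
  "cop_number G = (LEAST k. cops_win G k)"

(* So LEAST in cop_number is over a nonempty set. *)
lemma cops_win_card:
  assumes "pair_graph G"
  shows "cops_win G (card (pverts G))"
proof -
  interpret pair_graph G by fact
  obtain f where f: "bij_betw f {0..<card (pverts G)} (pverts G)"
    using ex_bij_betw_nat_finite pair_finite_verts by blast
  have fin: "f i \<in> pverts G" if "i < card (pverts G)" for i
    using f that by (auto simp: bij_betw_def)
  have "\<exists>i<card (pverts G). f i = v" if "v \<in> pverts G" for v
    using f that by (force simp: bij_betw_def)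
  with fin have "winning_strategy G (card (pverts G)) (\<lambda>_. f)"
    by (auto simp: winning_strategy_def cops_at_def legal_move_def robber_play_def)
  then show ?thesis unfolding cops_win_def by blast
qed

lemma pair_graph_undirected:
  assumes "finite V" "E \<subseteq> V \<times> V" "\<And>v. (v, v) \<notin> E"
  shows "pair_graph (undirected V E)"
proof -
  have "finite E" using assms by (meson finite_SigmaI finite_subset)
  with assms show ?thesis
    by unfold_locales (auto simp: undirected_def symmetric_def sym_def)
qed

lemma pair_graph_path_graph: "pair_graph (path_graph n)"
  unfolding path_graph_def by (rule pair_graph_undirected) auto

lemma pair_graph_cycle_graph: "n \<ge> 3 \<Longrightarrow> pair_graph (cycle_graph n)"
  unfolding cycle_graph_def
  by (rule pair_graph_undirected) (auto simp: mod_Suc split: if_split_asm intro: gr0I)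

lemma pair_graph_claw: "pair_graph claw"
  unfolding claw_def by (rule pair_graph_undirected) auto

lemma pair_graph_butterfly: "pair_graph butterfly"
  unfolding butterfly_def by (rule pair_graph_undirected) auto

end

theory Submission
  imports Defs
begin

text \<open>
  Replace every vertex \<open>u\<close> of \<open>G\<close> by a clique whose vertices are the darts \<open>(u, v)\<close> with \<open>v = u\<close> or
  \<open>v\<close> adjacent to \<open>u\<close>, and join \<open>(u, v)\<close> to \<open>(v, u)\<close>. In the resulting graph \<open>H\<close> every neighbourhood
  is a clique plus at most one further vertex, which excludes the claw and the butterfly. On an
  induced path or cycle (other than a triangle), clique edges and crossing edges alternate; this
  excludes \<open>C\<^sub>4\<close> and \<open>C\<^sub>5\<close>, and every second vertex of an induced \<open>P\<close> with \<open>2p + 1\<close> vertices yields a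
  path with \<open>p + 1\<close> vertices in \<open>G\<close>.

  Two crossing moves in a row lead back to the start, so two moves in \<open>H\<close> move the first component
  of a dart along at most one edge of \<open>G\<close>. Conversely, a robber can imitate a move from \<open>u\<close> to \<open>v\<close> in
  \<open>G\<close> by the two moves to \<open>(u, v)\<close> and to \<open>(v, u)\<close> in \<open>H\<close>. Hence the cops win on \<open>G\<close> by watching the
  first components of cops who win on \<open>H\<close>.
\<close>

section \<open>Induced subgraphs and vertex paths\<close>

text \<open>Reduces exclusion proofs to vertex maps: \<open>f\<close> inverts the isomorphism from
  the induced copy onto \<open>F\<close>, so its values are the vertices of that copy.\<close>

lemma not_induced_freeE:
  assumes "\<not> induced_free Fs G"
  obtains F f where "F \<in> Fs" "inj_on f (pverts F)" "f ` pverts F \<subseteq> pverts G"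
    "\<And>i j. i \<in> pverts F \<Longrightarrow> j \<in> pverts F \<Longrightarrow> (f i, f j) \<in> parcs G \<longleftrightarrow> (i, j) \<in> parcs F"
proof -
  obtain F K h where F: "F \<in> Fs" and K: "induced_subgraph K (with_proj G)"
    and h: "pre_digraph.digraph_isomorphism K h" and eq: "with_proj F = app_iso h K"
    using assms unfolding induced_free_def digraph_iso_def by blast
  let ?g = "iso_verts h"
  define f where "f = the_inv_into (verts K) ?g"
  have proj: "tail K = fst" "head K = snd"
    using K by (auto simp: induced_subgraph_def subgraph_def compatible_def)
  have arcsK: "arcs K = {e \<in> parcs G. fst e \<in> verts K \<and> snd e \<in> verts K}"
    and vertsK: "verts K \<subseteq> pverts G"
    using K by (auto simp: induced_subgraph_def subgraph_def)
  have inj: "inj_on ?g (verts K)"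
    using h by (simp add: pre_digraph.digraph_isomorphism_def)
  have vertsF: "pverts F = ?g ` verts K" and parcsF: "parcs F = iso_arcs h ` arcs K"
    and projF: "iso_tail h = fst" "iso_head h = snd"
    using arg_cong[OF eq, of verts] arg_cong[OF eq, of arcs] arg_cong[OF eq, of tail]
      arg_cong[OF eq, of head] by simp_all
  have ends: "iso_arcs h e = (?g (fst e), ?g (snd e))" if "e \<in> arcs K" for e
    using h that proj projF by (auto simp: pre_digraph.digraph_isomorphism_def prod_eq_iff)
  have arcF: "(?g u, ?g v) \<in> parcs F \<longleftrightarrow> (u, v) \<in> parcs G" if "u \<in> verts K" "v \<in> verts K" for u v
  proof
    assume "(?g u, ?g v) \<in> parcs F"
    then obtain e where e: "e \<in> arcs K" "(?g u, ?g v) = iso_arcs h e" unfolding parcsF by auto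
    then have "?g u = ?g (fst e)" "?g v = ?g (snd e)" using ends by auto
    then have "e = (u, v)"
      using e(1) that inj unfolding arcsK by (auto simp: prod_eq_iff dest: inj_onD)
    then show "(u, v) \<in> parcs G" using e(1) arcsK by auto
  next
    assume "(u, v) \<in> parcs G"
    then have "(u, v) \<in> arcs K" using that arcsK by auto
    then show "(?g u, ?g v) \<in> parcs F" unfolding parcsF using ends by force
  qed
  have fg: "f (?g u) = u" if "u \<in> verts K" for u
    unfolding f_def using inj that by (rule the_inv_into_f_f)
  show thesis
  proof (rule that[OF F])
    show "inj_on f (pverts F)" unfolding vertsF by (auto simp: inj_on_def fg)
    show "f ` pverts F \<subseteq> pverts G" unfolding vertsF using vertsK by (auto simp: fg)
    show "(f i, f j) \<in> parcs G \<longleftrightarrow> (i, j) \<in> parcs F" if "i \<in> pverts F" "j \<in> pverts F" for i j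
      using that arcF unfolding vertsF by (auto simp: fg)
  qed
qed

lemma arc_cycle_graph_iff:
  "i \<in> pverts (cycle_graph n) \<Longrightarrow> j \<in> pverts (cycle_graph n) \<Longrightarrow>
     (i, j) \<in> parcs (cycle_graph n) \<longleftrightarrow> j = Suc i mod n \<or> i = Suc j mod n"
  by (auto simp: cycle_graph_def undirected_def)

lemma in_set_vwalk_arcsE:
  assumes "e \<in> set (vwalk_arcs q)"
  obtains i where "Suc i < length q" "e = (q ! i, q ! Suc i)"
proof -
  have "\<exists>i. Suc i < length q \<and> e = (q ! i, q ! Suc i)"
    using assms
  proof (induction q rule: vwalk_arcs.induct)
    case (3 x y xs)
    then consider "e = (x, y)" | "e \<in> set (vwalk_arcs (y # xs))" by auto
    then show ?case
    proof cases
      case 1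
      then show ?thesis by (intro exI[of _ 0]) simp
    next
      case 2
      then obtain i where "Suc i < length (y # xs)" "e = ((y # xs) ! i, (y # xs) ! Suc i)"
        using 3 by blast
      then show ?thesis by (intro exI[of _ "Suc i"]) simp
    qed
  qed simp_all
  then show thesis using that by blast
qed

lemma vpath_map_upt:
  assumes "0 < n" "inj_on a {..<n}" "\<And>i. i < n \<Longrightarrow> a i \<in> pverts G"
    "\<And>i. Suc i < n \<Longrightarrow> (a i, a (Suc i)) \<in> parcs G"
  shows "vpath (map a [0..<n]) (with_proj G)"
proof -
  have "set (vwalk_arcs (map a [0..<n])) \<subseteq> parcs G"
    using assms(4) by (auto elim!: in_set_vwalk_arcsE)
  then show ?thesis
    using assms(1-3) by (auto simp: vpath_def vwalk_def distinct_map atLeast0LessThan)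
qed

section \<open>Freezing the cops after a capture\<close>

text \<open>A strategy also wins if it only guarantees that the robber walks onto a cop: from that moment
  on, let all cops stay put.\<close>

lemma cops_winI_freeze:
  assumes init: "\<And>i. i < k \<Longrightarrow> \<sigma> [] i \<in> pverts G"
    and legal: "\<And>r n i. robber_play G r \<Longrightarrow> i < k \<Longrightarrow>
      legal_move G (cops_at \<sigma> r n i) (cops_at \<sigma> r (Suc n) i)"
    and capture: "\<And>r. robber_play G r \<Longrightarrow>
      \<exists>n. \<exists>i<k. cops_at \<sigma> r n i = r n \<or> cops_at \<sigma> r (Suc n) i = r n"
  shows "cops_win G k"
proof -
  \<comment> \<open>\<open>T\<close> is the first time the robber stood on a cop with the cops still
    to move, capped by the length of the history; the cap also ensures that the minimum
    exists.\<close>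
  define T where "T rs = (LEAST m. length rs \<le> m \<or> (\<exists>i<k. \<sigma> (take m rs) i = rs ! m))" for rs
  define \<tau> where "\<tau> rs = \<sigma> (take (T rs) rs)" for rs
  define hit where "hit r m \<longleftrightarrow> (\<exists>i<k. cops_at \<sigma> r m i = r m)" for r m
  define S where "S r n = (LEAST m. n \<le> m \<or> hit r m)" for r n
  have S_le: "S r n \<le> n" for r n
    unfolding S_def by (rule Least_le) simp
  have T_map: "T (map r [0..<n]) = S r n" for r n
  proof -
    have "length (map r [0..<n]) \<le> m \<or> (\<exists>i<k. \<sigma> (take m (map r [0..<n])) i = map r [0..<n] ! m)
        \<longleftrightarrow> n \<le> m \<or> hit r m" for m
      by (cases "n \<le> m") (auto simp: hit_def cops_at_def take_map)
    then show ?thesis unfolding T_def S_def by presburger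
  qed
  have at: "cops_at \<tau> r n = cops_at \<sigma> r (S r n)" for r n
    using S_le[of r n] by (simp add: cops_at_def \<tau>_def T_map take_map)
  \<comment> \<open>The clock \<open>S r\<close> runs in step with \<open>n\<close> until the first
    hit and then stops, so a move under \<open>\<tau>\<close> is a move of \<open>\<sigma>\<close>
    or none.\<close>
  have S_Suc: "S r (Suc n) = S r n \<or> S r n = n \<and> S r (Suc n) = Suc n" for r n
  proof (cases "\<exists>m\<le>n. hit r m")
    case True
    then have ex: "\<exists>m. hit r m" by blast
    let ?M = "LEAST m. hit r m"
    have M: "hit r ?M" using ex by (rule LeastI_ex)
    have le: "?M \<le> n" using True by (meson Least_le order_trans)
    have "S r n' = ?M" if "?M \<le> n'" for n'
      unfolding S_def using M that by (intro Least_equality) (auto intro: Least_le)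
    then show ?thesis using le by simp
  next
    case False
    then have "Suc n \<le> m" if "hit r m" for m using that not_less_eq_eq by blast
    then have "S r n = n" "S r (Suc n) = Suc n"
      unfolding S_def by (auto intro!: Least_equality dest: Suc_leD)
    then show ?thesis by simp
  qed
  have "winning_strategy G k \<tau>"
    unfolding winning_strategy_def
  proof (intro conjI allI impI)
    show "\<tau> [] i \<in> pverts G" if "i < k" for i
      using init that by (simp add: \<tau>_def)
  next
    fix r n i assume r: "robber_play G r" and i: "i < k"
    have "legal_move G (cops_at \<sigma> r m i) (cops_at \<sigma> r m i)" for m
      using legal[OF r i, of m] by (simp add: legal_move_def)
    then show "legal_move G (cops_at \<tau> r n i) (cops_at \<tau> r (Suc n) i)"
      unfolding at using S_Suc[of r n]
      by (elim disjE conjE) (simp_all only: legal[OF r i])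
  next
    fix r assume r: "robber_play G r"
    show "\<exists>n. \<exists>i<k. cops_at \<tau> r (Suc n) i = r n"
    proof (cases "\<exists>m. hit r m")
      case True
      define M where "M = (LEAST m. hit r m)"
      have M: "hit r M" unfolding M_def using True by (rule LeastI_ex)
      then have "S r (Suc M) = M"
        unfolding S_def by (intro Least_equality) (auto intro: Least_le simp: M_def)
      \<comment> \<open>The cop frozen on \<open>r M\<close> captures formally by its next,
        stationary move.\<close>
      then have "cops_at \<tau> r (Suc M) = cops_at \<sigma> r M" by (simp add: at)
      with M show ?thesis unfolding hit_def by metis
    next
      case False
      then have "S r n = n" for n unfolding S_def by (auto intro: Least_equality)
      then show ?thesis using capture[OF r] False unfolding hit_def at by auto
    qed
  qed
  then show ?thesis unfolding cops_win_def by blast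
qed

section \<open>Replacing vertices by cliques\<close>

lemma (in pair_graph) finite_legal_moves: "finite {(u, v). legal_move G u v}"
proof (rule finite_subset)
  show "{(u, v). legal_move G u v} \<subseteq> pverts G \<times> pverts G"
    using wellformed' by (auto simp: legal_move_def)
qed (simp add: pair_finite_verts)

text \<open>The element \<open>x\<close> of \<open>W\<close> encodes the dart from \<open>src x\<close> to \<open>tgt x\<close>. The loops \<open>(u, u)\<close> only
  spare a case distinction for the graph without edges.\<close>

locale clique_substitution = pair_graph G for G :: "'a pair_pre_digraph" +
  fixes W :: "'b set" and src tgt :: "'b \<Rightarrow> 'a"
  assumes darts: "bij_betw (\<lambda>x. (src x, tgt x)) W {(u, v). legal_move G u v}"
begin

definition H :: "'b pair_pre_digraph" where
  "H = \<lparr>pverts = W, parcs = {(x, y). x \<in> W \<and> y \<in> W \<and> x \<noteq> y \<and>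
     (src x = src y \<or> src x = tgt y \<and> tgt x = src y)}\<rparr>"

definition dart :: "'a \<Rightarrow> 'a \<Rightarrow> 'b" where
  "dart u v = the_inv_into W (\<lambda>x. (src x, tgt x)) (u, v)"

lemma pverts_H [simp]: "pverts H = W"
  by (simp add: H_def)

lemma arc_H_iff: "(x, y) \<in> parcs H \<longleftrightarrow>
    x \<in> W \<and> y \<in> W \<and> x \<noteq> y \<and> (src x = src y \<or> src x = tgt y \<and> tgt x = src y)"
  by (simp add: H_def)

lemma legal_src_tgt: "x \<in> W \<Longrightarrow> legal_move G (src x) (tgt x)"
  using darts by (auto simp: bij_betw_def)

lemma dart_eqI: "x \<in> W \<Longrightarrow> y \<in> W \<Longrightarrow> src x = src y \<Longrightarrow> tgt x = tgt y \<Longrightarrow> x = y"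
  using darts by (auto simp: bij_betw_def inj_on_def)

lemma arc_sym: "(u, v) \<in> parcs G \<Longrightarrow> (v, u) \<in> parcs G"
  using pair_sym_arcs by (auto simp: symmetric_def dest: symD)

lemma legal_move_sym: "legal_move G u v \<Longrightarrow> legal_move G v u"
  using wellformed' by (auto simp: legal_move_def intro: arc_sym)

lemma dart:
  assumes "legal_move G u v"
  shows dart_in: "dart u v \<in> W" and src_dart: "src (dart u v) = u" and tgt_dart: "tgt (dart u v) = v"
proof -
  have im: "(u, v) \<in> (\<lambda>x. (src x, tgt x)) ` W" and inj: "inj_on (\<lambda>x. (src x, tgt x)) W"
    using darts assms by (auto simp: bij_betw_def)
  show "dart u v \<in> W" unfolding dart_def by (rule the_inv_into_into[OF inj im order_refl])
  show "src (dart u v) = u" "tgt (dart u v) = v"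
    using f_the_inv_into_f[OF inj im] by (auto simp: dart_def)
qed

lemma pair_graph_H: "pair_graph H"
proof -
  have fin: "finite W"
    using bij_betw_finite[OF darts] finite_legal_moves by simp
  have "finite (parcs H)"
    by (rule finite_subset[of _ "W \<times> W"]) (auto simp: arc_H_iff fin)
  then show ?thesis
    using fin by unfold_locales (auto simp: arc_H_iff symmetric_def intro!: symI)
qed

lemma src_in: "x \<in> W \<Longrightarrow> src x \<in> pverts G"
  using legal_src_tgt by (auto simp: legal_move_def)

text \<open>Walks of \<open>G\<close> lift: an arc from \<open>u\<close> to \<open>w\<close> becomes
  the edge from \<open>dart u w\<close> to \<open>dart w u\<close>, and cliques bridge consecutive
  arcs.\<close>

lemma connected_H:
  assumes "Digraph_Component.connected (with_proj G)"
  shows "Digraph_Component.connected (with_proj H)"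
proof -
  interpret H: pair_graph H by (rule pair_graph_H)
  have sc: "strongly_connected (with_proj G)"
    using assms pair_sym_arcs by (rule symmetric_connected_imp_strongly_connected[rotated])
  have clique: "x \<rightarrow>\<^sup>*\<^bsub>H\<^esub> y" if "x \<in> W" "y \<in> W" "src x = src y" for x y
    using that by (cases "x = y") (auto simp: arc_H_iff)
  have reach: "x \<rightarrow>\<^sup>*\<^bsub>H\<^esub> y" if "src x \<rightarrow>\<^sup>*\<^bsub>G\<^esub> v" "x \<in> W" "y \<in> W" "src y = v" for x y v
    using that(1,3,4)
  \<comment> \<open>The hypothesis is applied to \<open>dart u w\<close> instead of the final
    vertex.\<close>
  proof (induction arbitrary: y rule: reachable_induct)
    case base
    then show ?case using clique that(2) by auto
  next
    case (step u w)
    then have uw: "(u, w) \<in> parcs G" by simp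
    then have l: "legal_move G u w" "legal_move G w u"
      using wellformed' arc_sym by (auto simp: legal_move_def)
    have "x \<rightarrow>\<^sup>*\<^bsub>H\<^esub> dart u w" using step.IH dart[OF l(1)] by simp
    moreover have "dart u w \<rightarrow>\<^sup>*\<^bsub>H\<^esub> dart w u"
      using dart[OF l(1)] dart[OF l(2)] no_loops'[OF uw]
      by (intro H.reachable_adjI) (auto simp: arc_H_iff)
    moreover have "dart w u \<rightarrow>\<^sup>*\<^bsub>H\<^esub> y"
      using clique dart[OF l(2)] step.prems by simp
    ultimately show ?case
      by (blast intro: H.reachable_trans)
  qed
  have "strongly_connected (with_proj H)"
  proof
    obtain u where "u \<in> pverts G" using sc by (auto simp: strongly_connected_def)
    then have "dart u u \<in> W" by (intro dart_in) (simp add: legal_move_def)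
    then show "verts (with_proj H) \<noteq> {}" by auto
    show "x \<rightarrow>\<^sup>*\<^bsub>H\<^esub> y" if "x \<in> verts (with_proj H)" "y \<in> verts (with_proj H)" for x y
      using that sc src_in by (intro reach[of x "src y" y]) (auto simp: strongly_connected_def)
  qed
  then show ?thesis
    using H.reachable_mk_symmetricI
    by (auto simp: Digraph_Component.connected_def strongly_connected_def)
qed

subsection \<open>Forbidden induced subgraphs\<close>

text \<open>Both \<open>y\<close> and \<open>z\<close> must be the reversal of the dart
  \<open>x\<close>.\<close>

lemma crossing_unique:
  "(x, y) \<in> parcs H \<Longrightarrow> (x, z) \<in> parcs H \<Longrightarrow> src x \<noteq> src y \<Longrightarrow> src x \<noteq> src z \<Longrightarrow> y = z"
  unfolding arc_H_iff by (metis dart_eqI)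

lemma clique_arc: "x \<in> W \<Longrightarrow> y \<in> W \<Longrightarrow> x \<noteq> y \<Longrightarrow> src x = src y \<Longrightarrow> (x, y) \<in> parcs H"
  unfolding arc_H_iff by simp

text \<open>Two neighbours inside the clique of \<open>x\<close> would be adjacent, and two outside
  it would be equal by \<open>crossing_unique\<close>. All exclusions below rest on this
  dichotomy.\<close>

lemma nonadjacent_neighbours:
  assumes "(x, y) \<in> parcs H" "(x, z) \<in> parcs H" "y \<noteq> z" "(y, z) \<notin> parcs H"
  shows "src x = src y \<longleftrightarrow> src x \<noteq> src z"
  using assms crossing_unique[OF assms(1,2)] clique_arc[of y z] unfolding arc_H_iff by metis

lemma arc_H_sym: "(x, y) \<in> parcs H \<Longrightarrow> (y, x) \<in> parcs H"
  by (auto simp: arc_H_iff)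

text \<open>This is \<open>nonadjacent_neighbours\<close> at the middle vertex \<open>y\<close>,
  oriented for walking along a path or cycle.\<close>

lemma induced_path_alternates:
  assumes "(x, y) \<in> parcs H" "(y, z) \<in> parcs H" "x \<noteq> z" "(x, z) \<notin> parcs H"
  shows "src x = src y \<longleftrightarrow> src y \<noteq> src z"
  using nonadjacent_neighbours[OF arc_H_sym assms(2-4)] assms(1) by metis

lemma src_arc: "(x, y) \<in> parcs H \<Longrightarrow> src x \<noteq> src y \<Longrightarrow> (src x, src y) \<in> parcs G"
  using legal_src_tgt unfolding arc_H_iff legal_move_def by metis

text \<open>Three pairwise nonadjacent leaves cannot pairwise differ in lying inside or outside the
  clique of the centre.\<close>

lemma claw_free: "induced_free {claw} H"
proof (rule ccontr)
  assume "\<not> ?thesis"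
  then obtain f where inj: "inj_on f (pverts claw)" and
    arc: "\<And>i j. i \<in> pverts claw \<Longrightarrow> j \<in> pverts claw \<Longrightarrow> (f i, f j) \<in> parcs H \<longleftrightarrow> (i, j) \<in> parcs claw"
    by (rule not_induced_freeE) auto
  have v: "pverts claw = {0, 1, 2, 3}" by (auto simp: claw_def undirected_def)
  have a: "(f 0, f 1) \<in> parcs H" "(f 0, f 2) \<in> parcs H" "(f 0, f 3) \<in> parcs H"
    "(f 1, f 2) \<notin> parcs H" "(f 1, f 3) \<notin> parcs H" "(f 2, f 3) \<notin> parcs H"
    by (simp_all add: arc claw_def undirected_def)
  have d: "f 1 \<noteq> f 2" "f 1 \<noteq> f 3" "f 2 \<noteq> f 3"
    using inj unfolding v inj_on_def by simp_all
  have "src (f 0) = src (f 1) \<longleftrightarrow> src (f 0) \<noteq> src (f 2)"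
    "src (f 0) = src (f 1) \<longleftrightarrow> src (f 0) \<noteq> src (f 3)"
    "src (f 0) = src (f 2) \<longleftrightarrow> src (f 0) \<noteq> src (f 3)"
    by (intro nonadjacent_neighbours a d)+
  then show False by blast
qed

lemma butterfly_free: "induced_free {butterfly} H"
proof (rule ccontr)
  assume "\<not> ?thesis"
  then obtain f where inj: "inj_on f (pverts butterfly)" and
    arc: "\<And>i j. i \<in> pverts butterfly \<Longrightarrow> j \<in> pverts butterfly \<Longrightarrow>
      (f i, f j) \<in> parcs H \<longleftrightarrow> (i, j) \<in> parcs butterfly"
    by (rule not_induced_freeE) auto
  have v: "pverts butterfly = {0, 1, 2, 3, 4}" by (auto simp: butterfly_def undirected_def)
  have a: "(f 0, f 1) \<in> parcs H" "(f 0, f 2) \<in> parcs H" "(f 0, f 3) \<in> parcs H" "(f 0, f 4) \<in> parcs H"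
    "(f 1, f 3) \<notin> parcs H" "(f 1, f 4) \<notin> parcs H" "(f 2, f 3) \<notin> parcs H"
    by (simp_all add: arc butterfly_def undirected_def)
  have d: "f 1 \<noteq> f 2" "f 1 \<noteq> f 3" "f 1 \<noteq> f 4" "f 2 \<noteq> f 3" "f 3 \<noteq> f 4"
    using inj unfolding v inj_on_def by simp_all
  have "src (f 0) = src (f 1) \<longleftrightarrow> src (f 0) \<noteq> src (f 3)"
    "src (f 0) = src (f 1) \<longleftrightarrow> src (f 0) \<noteq> src (f 4)"
    "src (f 0) = src (f 2) \<longleftrightarrow> src (f 0) \<noteq> src (f 3)"
    by (intro nonadjacent_neighbours a d)+
  \<comment> \<open>One of the triangles has both outer vertices outside the clique of
    \<open>f 0\<close>, so they coincide.\<close>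
  then show False
    using crossing_unique[OF a(1,2)] crossing_unique[OF a(3,4)] d by blast
qed

lemma C4_free: "induced_free {cycle_graph 4} H"
proof (rule ccontr)
  assume "\<not> ?thesis"
  then obtain f where inj: "inj_on f (pverts (cycle_graph 4))" and
    arc: "\<And>i j. i \<in> pverts (cycle_graph 4) \<Longrightarrow> j \<in> pverts (cycle_graph 4) \<Longrightarrow>
      (f i, f j) \<in> parcs H \<longleftrightarrow> (i, j) \<in> parcs (cycle_graph 4)"
    by (rule not_induced_freeE) auto
  have v: "pverts (cycle_graph 4) = {0, 1, 2, 3}" by (auto simp: cycle_graph_def undirected_def)
  have a: "(f 0, f 1) \<in> parcs H" "(f 1, f 2) \<in> parcs H" "(f 2, f 3) \<in> parcs H"
    "(f 3, f 0) \<in> parcs H" "(f 0, f 2) \<notin> parcs H" "(f 1, f 3) \<notin> parcs H" "(f 2, f 0) \<notin> parcs H"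
    by (simp_all add: arc v arc_cycle_graph_iff)
  have d: "f 0 \<noteq> f 1" "f 0 \<noteq> f 2" "f 2 \<noteq> f 0" "f 1 \<noteq> f 3" "f 1 \<noteq> f 2" "f 2 \<noteq> f 3" "f 3 \<noteq> f 0"
    using inj unfolding v inj_on_def by simp_all
  have "src (f 0) = src (f 1) \<longleftrightarrow> src (f 1) \<noteq> src (f 2)"
    "src (f 1) = src (f 2) \<longleftrightarrow> src (f 2) \<noteq> src (f 3)"
    "src (f 2) = src (f 3) \<longleftrightarrow> src (f 3) \<noteq> src (f 0)"
    by (intro induced_path_alternates a d)+
  \<comment> \<open>Two opposite edges cross between the same two cliques, and two cliques determine
    the crossing; so distinct corners coincide.\<close>
  with a d show False unfolding arc_H_iff by (metis dart_eqI)
qed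

text \<open>Clique edges and crossing edges cannot alternate around an odd cycle.\<close>

lemma C5_free: "induced_free {cycle_graph 5} H"
proof (rule ccontr)
  assume "\<not> ?thesis"
  then obtain f where inj: "inj_on f (pverts (cycle_graph 5))" and
    arc: "\<And>i j. i \<in> pverts (cycle_graph 5) \<Longrightarrow> j \<in> pverts (cycle_graph 5) \<Longrightarrow>
      (f i, f j) \<in> parcs H \<longleftrightarrow> (i, j) \<in> parcs (cycle_graph 5)"
    by (rule not_induced_freeE) auto
  have v: "pverts (cycle_graph 5) = {0, 1, 2, 3, 4}" by (auto simp: cycle_graph_def undirected_def)
  have a: "(f 0, f 1) \<in> parcs H" "(f 1, f 2) \<in> parcs H" "(f 2, f 3) \<in> parcs H"
    "(f 3, f 4) \<in> parcs H" "(f 4, f 0) \<in> parcs H" "(f 0, f 2) \<notin> parcs H" "(f 1, f 3) \<notin> parcs H"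
    "(f 2, f 4) \<notin> parcs H" "(f 3, f 0) \<notin> parcs H" "(f 4, f 1) \<notin> parcs H"
    by (simp_all add: arc v arc_cycle_graph_iff)
  have d: "f 0 \<noteq> f 2" "f 1 \<noteq> f 3" "f 2 \<noteq> f 4" "f 3 \<noteq> f 0" "f 4 \<noteq> f 1"
    using inj unfolding v inj_on_def by simp_all
  have "src (f 0) = src (f 1) \<longleftrightarrow> src (f 1) \<noteq> src (f 2)"
    "src (f 1) = src (f 2) \<longleftrightarrow> src (f 2) \<noteq> src (f 3)"
    "src (f 2) = src (f 3) \<longleftrightarrow> src (f 3) \<noteq> src (f 4)"
    "src (f 3) = src (f 4) \<longleftrightarrow> src (f 4) \<noteq> src (f 0)"
    "src (f 4) = src (f 0) \<longleftrightarrow> src (f 0) \<noteq> src (f 1)"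
    by (intro induced_path_alternates a d)+
  then show False by metis
qed

lemma path_free:
  assumes "\<And>q. vpath q (with_proj G) \<Longrightarrow> length q \<le> p"
  shows "induced_free {path_graph (2 * p + 1)} H"
proof (rule ccontr)
  let ?P = "path_graph (2 * p + 1)"
  assume "\<not> ?thesis"
  then obtain f where inj: "inj_on f (pverts ?P)" and im: "f ` pverts ?P \<subseteq> W" and
    arc: "\<And>i j. i \<in> pverts ?P \<Longrightarrow> j \<in> pverts ?P \<Longrightarrow> (f i, f j) \<in> parcs H \<longleftrightarrow> (i, j) \<in> parcs ?P"
    by (rule not_induced_freeE) auto
  have v: "pverts ?P = {..<2 * p + 1}" by (simp add: path_graph_def undirected_def)
  have fW: "f i \<in> W" if "i < 2 * p + 1" for i using im that unfolding v by auto
  have neq: "f i \<noteq> f j" if "i < 2 * p + 1" "j < 2 * p + 1" "i \<noteq> j" for i j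
    using inj that unfolding v inj_on_def by blast
  have arc': "(f i, f j) \<in> parcs H \<longleftrightarrow> j = Suc i \<or> i = Suc j" if "i < 2 * p + 1" "j < 2 * p + 1" for i j
    using that arc[unfolded v] by (auto simp: path_graph_def undirected_def)
  \<comment> \<open>Of any two consecutive edges exactly one crosses, so every second vertex
    advances by one arc of \<open>G\<close>; the even indices from \<open>0\<close> to
    \<open>2 * p\<close> give \<open>p + 1\<close> vertices.\<close>
  define a where "a j = src (f (2 * j))" for j
  have "vpath (map a [0..<p + 1]) (with_proj G)"
  proof (rule vpath_map_upt)
    show "a j \<in> pverts G" if "j < p + 1" for j
      unfolding a_def using that by (intro src_in fW) simp
    show "inj_on a {..<p + 1}"
    proof (rule inj_onI, rule ccontr)
      fix i j assume ij: "i \<in> {..<p + 1}" "j \<in> {..<p + 1}" "a i = a j" "i \<noteq> j"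
      \<comment> \<open>A shared source makes the two vertices adjacent, but adjacent indices differ
        by 1 and these are both even.\<close>
      then have "(f (2 * i), f (2 * j)) \<in> parcs H"
        by (intro clique_arc fW neq) (auto simp: a_def)
      moreover have "2 * i < 2 * p + 1" "2 * j < 2 * p + 1" using ij by auto
      ultimately show False unfolding arc'[OF \<open>2 * i < _\<close> \<open>2 * j < _\<close>] by presburger
    qed
    show "(a j, a (Suc j)) \<in> parcs G" if "Suc j < p + 1" for j
    proof -
      let ?x = "f (2 * j)" and ?y = "f (2 * j + 1)" and ?z = "f (2 * j + 2)"
      have 1: "(?y, ?x) \<in> parcs H" "(?y, ?z) \<in> parcs H" "(?x, ?z) \<notin> parcs H" "?x \<noteq> ?z"
        using that neq[of "2 * j" "2 * j + 2"] by (simp_all add: arc')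
      then have "src ?y = src ?x \<longleftrightarrow> src ?y \<noteq> src ?z" by (intro nonadjacent_neighbours)
      then have "(src ?x, src ?z) \<in> parcs G"
        using src_arc[of ?x ?y] src_arc[of ?y ?z] 1 arc_H_sym by metis
      then show ?thesis by (simp add: a_def)
    qed
  qed simp
  then show False using assms[of "map a [0..<p + 1]"] by simp
qed

subsection \<open>The game\<close>

text \<open>At the start, where \<open>0 - 1 = 0\<close>, both moves lead to \<open>(r 0, r 0)\<close>, so \<open>2 * n\<close> rounds in
  \<open>H\<close> match \<open>n\<close> rounds in \<open>G\<close>.\<close>

definition lift_play :: "(nat \<Rightarrow> 'a) \<Rightarrow> nat \<Rightarrow> 'b" where
  "lift_play r j = (let n = j div 2 in if even j then dart (r (n - 1)) (r n) else dart (r n) (r (n - 1)))"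

lemma legal_move_H_iff: "legal_move H x y \<longleftrightarrow>
    x \<in> W \<and> y \<in> W \<and> (src x = src y \<or> src x = tgt y \<and> tgt x = src y)"
  by (auto simp: legal_move_def arc_H_iff)

text \<open>At \<open>n = 0\<close> truncated subtraction makes this the stationary move, so the
  darts in \<open>lift_play\<close> are legal from the start.\<close>

lemma robber_play_prev:
  assumes "robber_play G r"
  shows "legal_move G (r (n - 1)) (r n)"
  using assms by (cases n) (auto simp: robber_play_def legal_move_def)

text \<open>From even times the lifted robber reverses his dart, which takes him to the clique of
  \<open>r n\<close>; from odd times he stays there and selects the dart of his next move.\<close>

lemma robber_play_lift:
  assumes r: "robber_play G r"
  shows "robber_play H (lift_play r)"
  unfolding robber_play_def
proof (intro conjI allI)
  show "lift_play r 0 \<in> pverts H"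
    using robber_play_prev[OF r, of 0] by (simp add: lift_play_def dart_in)
next
  fix j :: nat
  define n where "n = j div 2"
  have n: "j = 2 * n \<or> j = Suc (2 * n)" unfolding n_def by presburger
  have l: "legal_move G (r (n - 1)) (r n)" "legal_move G (r n) (r (n - 1))"
    "legal_move G (r n) (r (Suc n))"
    using robber_play_prev[OF r] r legal_move_sym unfolding robber_play_def by blast+
  show "legal_move H (lift_play r j) (lift_play r (Suc j))"
    using n
  proof
    assume "j = 2 * n"
    then show ?thesis
      using dart[OF l(1)] dart[OF l(2)] by (simp add: lift_play_def legal_move_H_iff)
  next
    assume "j = Suc (2 * n)"
    then show ?thesis
      using dart[OF l(2)] dart[OF l(3)] by (simp add: lift_play_def legal_move_H_iff)
  qed
qed

text \<open>Only two crossings could carry the source along two arcs, but the second crossing undoes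
  the first.\<close>

lemma legal_two_moves:
  assumes "legal_move H x y" "legal_move H y z"
  shows "legal_move G (src x) (src z)"
proof (cases "src x = src y \<or> src y = src z")
  case True
  have "legal_move G (src u) (src v)" if "legal_move H u v" for u v
    using that src_in[of u] src_arc[of u v] unfolding legal_move_def by force
  with True assms show ?thesis by metis
next
  case False
  then have "x = z" using assms crossing_unique[of y x z] arc_H_sym
    by (auto simp: legal_move_def)
  then show ?thesis using assms src_in by (auto simp: legal_move_def)
qed

lemma cops_win_of_H:
  assumes "cops_win H k"
  shows "cops_win G k"
proof -
  obtain \<sigma> where \<sigma>: "winning_strategy H k \<sigma>" using assms by (auto simp: cops_win_def)
  define \<tau> where
    "\<tau> rs i = src (\<sigma> (map (lift_play ((!) rs)) [0..<2 * length rs]) i)" for rs i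
  have at: "cops_at \<tau> r n i = src (cops_at \<sigma> (lift_play r) (2 * n) i)" for r n i
  proof -
    \<comment> \<open>Lifted positions at times below \<open>2 * n\<close> read only robber
      positions before \<open>n\<close>, so \<open>\<tau>\<close> never looks past its
      history.\<close>
    have "lift_play ((!) (map r [0..<n])) j = lift_play r j" if "j < 2 * n" for j
    proof -
      have "j div 2 < n" "j div 2 - 1 < n" using that by auto
      then show ?thesis by (simp add: lift_play_def Let_def)
    qed
    then have "map (lift_play ((!) (map r [0..<n]))) [0..<2 * n] = map (lift_play r) [0..<2 * n]"
      by (intro map_cong[OF refl]) simp
    then show ?thesis by (simp add: cops_at_def \<tau>_def del: map_eq_conv)
  qed
  show ?thesis
  proof (rule cops_winI_freeze)
    show "\<tau> [] i \<in> pverts G" if "i < k" for i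
      using \<sigma> that src_in by (simp add: \<tau>_def winning_strategy_def)
  next
    fix r n i assume r: "robber_play G r" and i: "i < k"
    have "legal_move H (cops_at \<sigma> (lift_play r) m i) (cops_at \<sigma> (lift_play r) (Suc m) i)" for m
      using \<sigma> i robber_play_lift[OF r] by (simp add: winning_strategy_def)
    from legal_two_moves[OF this this]
    show "legal_move G (cops_at \<tau> r n i) (cops_at \<tau> r (Suc n) i)" by (simp add: at)
  next
    fix r assume r: "robber_play G r"
    obtain m i where i: "i < k" and m: "cops_at \<sigma> (lift_play r) (Suc m) i = lift_play r m"
      using \<sigma> robber_play_lift[OF r] by (auto simp: winning_strategy_def)
    define n where "n = m div 2"
    have l: "legal_move G (r (n - 1)) (r n)" "legal_move G (r n) (r (n - 1))"
      using robber_play_prev[OF r] legal_move_sym by blast+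
    show "\<exists>n. \<exists>i<k. cops_at \<tau> r n i = r n \<or> cops_at \<tau> r (Suc n) i = r n"
    proof (cases "even m")
      case False
      \<comment> \<open>A capture by move \<open>2 * Suc n\<close> in \<open>H\<close> ends a full
        round of \<open>G\<close>.\<close>
      then have "m = Suc (2 * n)" unfolding n_def by presburger
      with m have "cops_at \<sigma> (lift_play r) (2 * Suc n) i = dart (r n) (r (n - 1))"
        by (simp add: lift_play_def)
      then have "cops_at \<tau> r (Suc n) i = r n" using src_dart[OF l(2)] unfolding at by simp
      then show ?thesis using i by blast
    next
      case True
      \<comment> \<open>Here the capture falls in mid-round, so the cop is viewed one move earlier:
        its source is the robber's old position, a capture, or the new one, onto which he then
        walked. The latter outcome calls for \<open>cops_winI_freeze\<close>.\<close>
      let ?x = "cops_at \<sigma> (lift_play r) (2 * n) i"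
      have "m = 2 * n" using True by (simp add: n_def)
      with m have "cops_at \<sigma> (lift_play r) (Suc (2 * n)) i = dart (r (n - 1)) (r n)"
        by (simp add: lift_play_def)
      moreover have "legal_move H ?x (cops_at \<sigma> (lift_play r) (Suc (2 * n)) i)"
        using \<sigma> i robber_play_lift[OF r] by (simp add: winning_strategy_def)
      ultimately have "src ?x = r (n - 1) \<or> src ?x = r n"
        using dart[OF l(1)] by (auto simp: legal_move_H_iff)
      then have *: "cops_at \<tau> r n i = r (n - 1) \<or> cops_at \<tau> r n i = r n" by (simp add: at)
      show ?thesis
      proof (cases n)
        \<comment> \<open>Both alternatives say that the robber started on a cop.\<close>
        case 0
        with * have "cops_at \<tau> r n i = r n" by simp
        with i show ?thesis by blast
      next
        case (Suc n')
        with * have "cops_at \<tau> r (Suc n') i = r n' \<or> cops_at \<tau> r n i = r n" by simp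
        with i show ?thesis by blast
      qed
    qed
  qed
qed

lemma cop_number_le_H: "cop_number G \<le> cop_number H"
proof -
  have "cops_win H (cop_number H)"
    unfolding cop_number_def using cops_win_card[OF pair_graph_H] by (rule LeastI)
  then show ?thesis unfolding cop_number_def[of G] by (intro Least_le cops_win_of_H)
qed

end

theorem theorem1p3:
  fixes G :: "'a pair_pre_digraph" and p t :: nat
  assumes "pair_graph G"
    and "Digraph_Component.connected (with_proj G)"
    and "longest_path_length G p"
    and "cop_number G \<ge> t"
  shows "\<exists>H :: nat pair_pre_digraph.
           pair_graph H \<and> Digraph_Component.connected (with_proj H) \<and>
           induced_free {path_graph (2 * p + 1), claw, butterfly, cycle_graph 4, cycle_graph 5} H \<and>
           cop_number H \<ge> t"
proof -
  interpret pair_graph G by fact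
  let ?D = "{(u, v). legal_move G u v}"
  \<comment> \<open>Numbering the darts gives \<open>H\<close> vertices of type
    \<open>nat\<close>.\<close>
  obtain h where h: "bij_betw h {0..<card ?D} ?D"
    using ex_bij_betw_nat_finite[OF finite_legal_moves] by blast
  interpret C: clique_substitution G "{0..<card ?D}" "fst \<circ> h" "snd \<circ> h"
    using h by unfold_locales simp
  have "induced_free {path_graph (2 * p + 1)} C.H"
    using assms(3) by (intro C.path_free) (simp add: longest_path_length_def)
  then have "induced_free {path_graph (2 * p + 1), claw, butterfly, cycle_graph 4, cycle_graph 5} C.H"
    using C.claw_free C.butterfly_free C.C4_free C.C5_free unfolding induced_free_def by blast
  then show ?thesis
    using C.pair_graph_H C.connected_H[OF assms(2)] C.cop_number_le_H assms(4) by fastforce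
qed

end
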